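(* Let $E$ be an elliptic curve defined over $\mathbb{Q}$ such that $E(\mathbb{Q})_{\rm tors}$ contains a subgroup isomorphic to $C_5$. Then $\sqrt{\Delta(E)}\notin\mathbb{Q}$.
   Context: $C_n$ is the cyclic group of order $n$; $E(\mathbb{Q})_{\rm tors}$ is the torsion subgroup of $E(\mathbb{Q})$. For a short Weierstrass model $Y^2=X^3+AX+B$ ($A,B\in\mathbb{Z}$) of $E$, $\Delta(E)=-2^4(4A^3+27B^2)$; whether $\Delta(E)$ is a square in $\mathbb{Q}$ (written $\sqrt{\Delta(E)}\in\mathbb{Q}$) does not depend on the chosen short model. *)

theory Defs
  imports Complex_Main "HOL-Algebra.Elementary_Groups"
begin

(* Weierstrass a1 a2 a3 a4 a6 stands for y^2 + a1 x y + a3 y = x^3 + a2 x^2 + a4 x + a6. *)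
datatype weierstrass = Weierstrass rat rat rat rat rat

fun discriminant :: "weierstrass \<Rightarrow> rat" where
  "discriminant (Weierstrass a1 a2 a3 a4 a6) =
    (let b2 = a1^2 + 4 * a2;
         b4 = 2 * a4 + a1 * a3;
         b6 = a3^2 + 4 * a6;
         b8 = a1^2 * a6 + 4 * a2 * a6 - a1 * a3 * a4 + a2 * a3^2 - a4^2
     in - (b2^2) * b8 - 8 * b4^3 - 27 * b6^2 + 9 * b2 * b4 * b6)"

definition elliptic_curve :: "weierstrass \<Rightarrow> bool" where
  "elliptic_curve E \<longleftrightarrow> discriminant E \<noteq> 0"

datatype point = Infinity | Affine rat rat

fun on_curve :: "weierstrass \<Rightarrow> point \<Rightarrow> bool" where
  "on_curve E Infinity \<longleftrightarrow> True"
| "on_curve (Weierstrass a1 a2 a3 a4 a6) (Affine x y) \<longleftrightarrow>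
    y^2 + a1 * x * y + a3 * y = x^3 + a2 * x^2 + a4 * x + a6"

(* Chord-tangent law. If x1 = x2 but the points are not opposite, then they coincide, and
   l is the slope of the tangent. *)
fun add_point :: "weierstrass \<Rightarrow> point \<Rightarrow> point \<Rightarrow> point" where
  "add_point E Infinity Q = Q"
| "add_point E P Infinity = P"
| "add_point (Weierstrass a1 a2 a3 a4 a6) (Affine x1 y1) (Affine x2 y2) =
    (if x1 = x2 \<and> y1 + y2 + a1 * x2 + a3 = 0 then Infinity
     else let l = (if x1 \<noteq> x2 then (y2 - y1) / (x2 - x1)
                   else (3 * x1^2 + 2 * a2 * x1 + a4 - a1 * y1) / (2 * y1 + a1 * x1 + a3));
              x3 = l^2 + a1 * l - a2 - x1 - x2
          in Affine x3 (- (l + a1) * x3 - (y1 - l * x1) - a3))"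

definition mordell_weil :: "weierstrass \<Rightarrow> point monoid" where
  "mordell_weil E = \<lparr>carrier = {P. on_curve E P}, mult = add_point E, one = Infinity\<rparr>"

definition torsion_group :: "weierstrass \<Rightarrow> point monoid" where
  "torsion_group E = (mordell_weil E)
    \<lparr>carrier := {P \<in> carrier (mordell_weil E).
        \<exists>n::nat. n > 0 \<and> P [^]\<^bsub>mordell_weil E\<^esub> n = \<one>\<^bsub>mordell_weil E\<^esub>}\<rparr>"

(* change_of_variables u r s t E E': substituting x = u^2 x' + r, y = u^3 y' + s u^2 x' + t
   in E and dividing by u^6 yields E'. *)
fun change_of_variables ::
  "rat \<Rightarrow> rat \<Rightarrow> rat \<Rightarrow> rat \<Rightarrow> weierstrass \<Rightarrow> weierstrass \<Rightarrow> bool" where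
  "change_of_variables u r s t (Weierstrass a1 a2 a3 a4 a6) (Weierstrass a1' a2' a3' a4' a6') \<longleftrightarrow>
    u \<noteq> 0 \<and>
    u * a1' = a1 + 2 * s \<and>
    u^2 * a2' = a2 - s * a1 + 3 * r - s^2 \<and>
    u^3 * a3' = a3 + r * a1 + 2 * t \<and>
    u^4 * a4' = a4 - s * a3 + 2 * r * a2 - (t + r * s) * a1 + 3 * r^2 - 2 * s * t \<and>
    u^6 * a6' = a6 + r * a4 + r^2 * a2 + r^3 - t * a3 - t^2 - r * t * a1"

definition short_weierstrass :: "int \<Rightarrow> int \<Rightarrow> weierstrass" where
  "short_weierstrass A B = Weierstrass 0 0 0 (of_int A) (of_int B)"

definition short_model :: "weierstrass \<Rightarrow> int \<Rightarrow> int \<Rightarrow> bool" where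
  "short_model E A B \<longleftrightarrow> (\<exists>u r s t. change_of_variables u r s t E (short_weierstrass A B))"

definition short_discriminant :: "int \<Rightarrow> int \<Rightarrow> int" where
  "short_discriminant A B = - (2^4) * (4 * A^3 + 27 * B^2)"

lemma discriminant_short_weierstrass:
  "discriminant (short_weierstrass A B) = of_int (short_discriminant A B)"
  by (simp add: short_weierstrass_def short_discriminant_def Let_def power_mult_distrib algebra_simps)

lemma discriminant_change_of_variables:
  assumes "change_of_variables u r s t E E'"
  shows "u^12 * discriminant E' = discriminant E"
proof -
  obtain a1 a2 a3 a4 a6 where E: "E = Weierstrass a1 a2 a3 a4 a6" by (cases E)
  obtain a1' a2' a3' a4' a6' where E': "E' = Weierstrass a1' a2' a3' a4' a6'" by (cases E')
  define c1 c2 c3 c4 c6 where c: "c1 = u * a1'" "c2 = u^2 * a2'" "c3 = u^3 * a3'"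
    "c4 = u^4 * a4'" "c6 = u^6 * a6'"
  have "u^12 * discriminant E' = discriminant (Weierstrass c1 c2 c3 c4 c6)"
    unfolding E' c by (simp add: Let_def) algebra
  moreover have "c1 = a1 + 2 * s" "c2 = a2 - s * a1 + 3 * r - s^2" "c3 = a3 + r * a1 + 2 * t"
    "c4 = a4 - s * a3 + 2 * r * a2 - (t + r * s) * a1 + 3 * r^2 - 2 * s * t"
    "c6 = a6 + r * a4 + r^2 * a2 + r^3 - t * a3 - t^2 - r * t * a1"
    using assms unfolding E E' c by simp_all
  moreover have "discriminant (Weierstrass (a1 + 2 * s) (a2 - s * a1 + 3 * r - s^2) (a3 + r * a1 + 2 * t)
    (a4 - s * a3 + 2 * r * a2 - (t + r * s) * a1 + 3 * r^2 - 2 * s * t)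
    (a6 + r * a4 + r^2 * a2 + r^3 - t * a3 - t^2 - r * t * a1)) = discriminant E"
    unfolding E by (simp add: Let_def) algebra
  ultimately show ?thesis by simp
qed

lemma ex_short_model: "\<exists>A B. short_model E A B"
proof -
  obtain a1 a2 a3 a4 a6 where E: "E = Weierstrass a1 a2 a3 a4 a6" by (cases E)
  define b2 b4 b6 where b: "b2 = a1^2 + 4 * a2" "b4 = 2 * a4 + a1 * a3" "b6 = a3^2 + 4 * a6"
  define c4 c6 where c: "c4 = b2^2 - 24 * b4" "c6 = - (b2^3) + 36 * b2 * b4 - 216 * b6"
  obtain m n where m: "c4 = of_int m / of_int n" "n > 0"
    by (metis quotient_of_div quotient_of_denom_pos surj_pair)
  obtain k l where k: "c6 = of_int k / of_int l" "l > 0"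
    by (metis quotient_of_div quotient_of_denom_pos surj_pair)
  define d where "d = (of_int (n * l) :: rat)"
  define A where "A = - 27 * m * n^3 * l^4"
  define B where "B = - 54 * k * n^6 * l^5"
  have d: "d \<noteq> 0" using m k by (simp add: d_def)
  have A: "of_int A = - 27 * c4 * d^4" using m k
    by (simp add: A_def d_def power_mult_distrib field_simps power_numeral_reduce)
  have B: "of_int B = - 54 * c6 * d^6" using m k
    by (simp add: B_def d_def power_mult_distrib field_simps power_numeral_reduce)
  define s r where s: "s = - a1 / 2" and r: "r = - b2 / 12"
  define t where t: "t = - (a3 + r * a1) / 2"
  have p: "(1 / (6 * d))^4 * (- 27 * c4 * d^4) = - c4 / 48"
    "(1 / (6 * d))^6 * (- 54 * c6 * d^6) = - c6 / 864"
    using d by (simp_all add: field_simps)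
  have "change_of_variables (1 / (6 * d)) r s t E (short_weierstrass A B)"
    unfolding E short_weierstrass_def change_of_variables.simps A B p using d
    by (simp add: s r t b c field_simps; algebra)
  then show ?thesis unfolding short_model_def by blast
qed

end

theory Submission
  imports Defs "HOL-Computational_Algebra.Nth_Powers"
begin

text \<open>
  A curve with a rational point of order 5 is, up to a change of variables, a member of Tate's
  family, and a change of variables multiplies the discriminant by a 12th power. So the
  discriminant equals \<open>t * (t^2 - 11 * t - 1)\<close> up to a nonzero square factor, for some rational
  \<open>t \<noteq> 0\<close> (lemma \<open>discriminant_of_order_five\<close>). If it were a square, then \<open>t\<close> would be the first
  coordinate of a rational point on \<open>y^2 = t * (t^2 - 11 * t - 1)\<close>. That curve has rank 0, and its
  only affine rational point is \<open>(0, 0)\<close> (lemma \<open>square_discriminant_curve_points\<close>), a contradiction.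

  The curve is treated by descent through a 2-isogeny and its dual, in elementary terms. A point
  with \<open>t \<noteq> 0\<close> gives coprime integers with \<open>v^2 = u^4 - 11 * u^2 * e^2 - e^4\<close> and \<open>e \<noteq> 0\<close>; a first
  lift yields \<open>u^2 = a^4 + 22 * a^2 * b^2 + 125 * b^4\<close>, and a second one leads back to the first
  equation with a smaller value of \<open>e\<close>.
\<close>

section \<open>Coprimality and squares\<close>

lemma coprime_if_no_common_prime:
  fixes a b :: int
  assumes "\<And>p. prime p \<Longrightarrow> p dvd a \<Longrightarrow> p dvd b \<Longrightarrow> False"
  shows "coprime a b"
proof (rule ccontr)
  assume "\<not> coprime a b"
  then have nu: "\<not> is_unit (gcd a b)" unfolding is_unit_gcd .
  show False
  proof (cases "gcd a b = 0")
    case True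
    then show False using assms[of 2] by simp
  next
    case False
    then obtain p where "prime p" "p dvd gcd a b" using nu by (meson prime_divisor_exists)
    then show False using assms by auto
  qed
qed

lemma coprime_factors_of_power:
  fixes a b c :: int
  assumes "coprime a b" "a * b = c ^ k"
  obtains x y :: int where "\<bar>a\<bar> = x ^ k" "\<bar>b\<bar> = y ^ k"
proof -
  have "nat \<bar>a\<bar> * nat \<bar>b\<bar> = nat \<bar>c\<bar> ^ k"
    using assms(2) by (metis abs_mult nat_abs_mult_distrib nat_power_eq power_abs abs_ge_zero)
  moreover have "coprime (nat \<bar>a\<bar>) (nat \<bar>b\<bar>)" using assms(1) by simp
  ultimately have "is_nth_power k (nat \<bar>a\<bar>) \<and> is_nth_power k (nat \<bar>b\<bar>)"
    by (metis is_nth_power_mult_coprime_nat_iff is_nth_power_nth_power)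
  then obtain x y where "nat \<bar>a\<bar> = x ^ k" "nat \<bar>b\<bar> = y ^ k" by (auto simp: is_nth_power_def)
  then show thesis by (intro that[of "int x" "int y"]) (metis abs_ge_zero int_nat_eq of_nat_power)+
qed

lemma square_mod_8: "(x::int)^2 mod 8 \<in> {0, 1, 4}" "odd x \<Longrightarrow> x^2 mod 8 = 1"
proof -
  have "x mod 8 \<in> {0,1,2,3,4,5,6,7}" by auto
  moreover have "x^2 mod 8 = (x mod 8)^2 mod 8" by (simp add: power_mod)
  ultimately show "x^2 mod 8 \<in> {0, 1, 4}" by auto
  assume "odd x"
  then have "x mod 8 = 1 \<or> x mod 8 = 3 \<or> x mod 8 = 5 \<or> x mod 8 = 7" by presburger
  with \<open>x^2 mod 8 = (x mod 8)^2 mod 8\<close> show "x^2 mod 8 = 1" by auto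
qed

lemma no_square_22_mod_5:
  fixes u f :: int
  assumes "5 dvd u^2 - 22 * f^2"
  shows "5 dvd u \<and> 5 dvd f"
proof -
  have "(u^2 - 22 * f^2) mod 5 = ((u mod 5)^2 - 22 * (f mod 5)^2) mod 5"
    by (intro mod_diff_cong mod_mult_cong) (simp_all add: power_mod)
  then have "((u mod 5)^2 - 22 * (f mod 5)^2) mod 5 = 0" using assms by simp
  moreover have "u mod 5 \<in> {0,1,2,3,4}" "f mod 5 \<in> {0,1,2,3,4}" by auto
  moreover have residues: "x = 0 \<and> y = 0"
    if "(x^2 - 22 * y^2) mod 5 = 0" "x \<in> {0,1,2,3,4}" "y \<in> {0,1,2,3,4}" for x y :: int
    using that by auto
  ultimately show ?thesis unfolding dvd_eq_mod_eq_0 by (intro residues)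
qed

lemma rat_square_eq_int:
  fixes y :: rat
  assumes "y^2 = of_int k"
  obtains z :: int where "y = of_int z"
proof -
  obtain p q where pq: "quotient_of y = (p, q)" by fastforce
  have y: "y = of_int p / of_int q" and q: "q > 0" and co: "coprime p q"
    using pq quotient_of_div quotient_of_denom_pos quotient_of_coprime by auto
  have "(of_int (p^2) :: rat) = of_int (k * q^2)"
    using assms q unfolding y by (simp add: field_simps)
  then have "p^2 = k * q^2" by (simp only: of_int_eq_iff)
  then have "q^2 dvd p^2" by simp
  then have "q dvd p" by simp
  then have "is_unit q" using co by (meson coprime_common_divisor dvd_refl)
  then have "q = 1" using q by simp
  then show thesis using that[of p] y by simp
qed

section \<open>Rational points on a curve of rank 0\<close>

text \<open>If \<open>e\<close> were odd, the right-hand side would be 7, 3 or 5 modulo 8, which are not squares.\<close>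

lemma quartic_denominator_even:
  fixes u e v :: int
  assumes eq: "v^2 = u^4 - 11 * u^2 * e^2 - e^4"
  shows "even e"
proof (rule ccontr)
  assume "odd e"
  define U where "U = u^2"
  define D where "D = e^2"
  have D: "D mod 8 = 1" and U: "U mod 8 \<in> {0,1,4}" and V: "v^2 mod 8 \<in> {0,1,4}"
    using square_mod_8 \<open>odd e\<close> by (simp_all add: U_def D_def del: insert_iff)
  have "v^2 = U * U - 11 * U * D - D * D" using eq by (simp add: U_def D_def flip: power_add)
  also have "\<dots> mod 8 = ((U mod 8) * (U mod 8) - 11 * (U mod 8) * (D mod 8) - (D mod 8) * (D mod 8)) mod 8"
    by (intro mod_diff_cong mod_mult_cong) simp_all
  finally show False using U V unfolding D by auto
qed

text \<open>This half of the descent lifts a point through the 2-isogeny from \<open>Y^2 = X * (X^2 + 22 * X + 125)\<close>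
to \<open>y^2 = t * (t^2 - 11 * t - 1)\<close>, with \<open>t = u^2 / e^2\<close> and \<open>X = a^2 / b^2\<close>. Completing the square turns the equation into
\<open>p * q = 125 * (e / 2)^4\<close> with \<open>p + q = u^2 - 22 * (e / 2)^2\<close>. The factors are coprime: the only prime
that could divide both is 5, and it does not because 22 is not a square modulo 5. So up to a common
sign they are \<open>a^4\<close> and \<open>125 * b^4\<close>, and the negative sign contradicts \<open>u^2 > 0\<close>.\<close>

lemma quartic_point_lifts:
  fixes u e v :: int
  assumes co: "coprime u e" and e0: "e \<noteq> 0" and eq: "v^2 = u^4 - 11 * u^2 * e^2 - e^4"
  obtains a b where "coprime a b" "e^2 = 4 * a^2 * b^2" "u^2 = a^4 + 22 * a^2 * b^2 + 125 * b^4"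
proof -
  note conclude = that
  have "even e" using quartic_denominator_even[OF eq] .
  then obtain f where f: "e = 2 * f" by blast
  have odd: "odd u" using co \<open>even e\<close> coprime_common_divisor[of u e 2] by auto
  have cof: "coprime u f" using co by (simp add: f)
  \<comment> \<open>The equation becomes \<open>v^2 = X^2 - 500 * f^4\<close>, and \<open>p\<close>, \<open>q\<close> are the halves of \<open>X - v\<close> and \<open>X + v\<close>.\<close>
  define X where "X = u^2 - 22 * f^2"
  have "odd (v^2)" using odd unfolding eq f by simp
  then have "even (X - v)" "even (X + v)" using odd by (auto simp: X_def)
  then obtain p q where "X - v = 2 * p" "X + v = 2 * q" by (metis dvdE)
  then have pq: "X = p + q" "v = q - p" by auto
  have prod: "p * q = 125 * f^4"
  proof -
    have "4 * (p * q) = X^2 - v^2" unfolding pq by algebra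
    also have "\<dots> = 4 * (125 * f^4)" unfolding eq X_def f by algebra
    finally show ?thesis by simp
  qed
  have copq: "coprime p q"
  proof (rule coprime_if_no_common_prime)
    fix l :: int assume l: "prime l" "l dvd p" "l dvd q"
    have lX: "l dvd u^2 - 22 * f^2" using l pq X_def by (metis dvd_add)
    have nf: "\<not> l dvd f"
    proof
      assume lf: "l dvd f"
      then have "l dvd 22 * f^2" by (simp add: power2_eq_square)
      then have "l dvd u^2" using lX by (metis diff_add_cancel dvd_add)
      then have "l dvd u" using l prime_dvd_power by blast
      then show False using lf cof l by (meson coprime_common_divisor not_prime_unit)
    qed
    have "l dvd 125 * f^4" using l prod by (metis dvd_mult2)
    moreover have "\<not> l dvd f^4" using nf l(1) prime_dvd_power by blast
    ultimately have "l dvd 125" using l(1) by (simp only: prime_dvd_mult_iff) blast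
    then have "l dvd 5^3" by simp
    then have "l dvd 5" using l prime_dvd_power by blast
    moreover have "prime (5::int)" by simp
    ultimately have "l = 5" using l(1) primes_dvd_imp_eq by blast
    then show False using lX nf no_square_22_mod_5 by blast
  qed
  \<comment> \<open>The roles of \<open>p\<close> and \<open>q\<close> are interchanged by the sign of \<open>v\<close>, so 125 may be assumed to divide \<open>q\<close>.\<close>
  have main: thesis if copq: "coprime p q" and prod: "p * q = 125 * f^4" and X: "X = p + q"
    and d: "125 dvd q" for p q
  proof -
    obtain r where r: "q = 125 * r" using d by blast
    have "p * r = f^4" using prod r by simp
    moreover have "coprime p r" using copq r by simp
    ultimately obtain a b where ab: "\<bar>p\<bar> = a^4" "\<bar>r\<bar> = b^4" using coprime_factors_of_power by metis
    have "f^4 = (a * b)^4" using \<open>p * r = f^4\<close> ab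
      by (metis abs_mult power_mult_distrib abs_of_nonneg zero_le_even_power even_numeral)
    then have "(f^2)^2 = ((a * b)^2)^2" by simp
    then have f2: "f^2 = (a * b)^2" using power2_eq_iff_nonneg[of "f^2" "(a*b)^2"] by simp
    have "f \<noteq> 0" using e0 f by simp
    have pr: "p * r > 0" using \<open>p * r = f^4\<close> \<open>f \<noteq> 0\<close> by simp
    have pos: "p > 0"
    proof (rule ccontr)
      assume "\<not> p > 0"
      then have "p < 0" "r < 0" using pr by (auto simp: zero_less_mult_iff)
      then have "u^2 = 22 * f^2 - a^4 - 125 * b^4" using X ab r X_def by simp
      also have "\<dots> = - ((a^2 - 11 * b^2)^2 + 4 * (b^2)^2)" unfolding f2 by algebra
      also have "\<dots> \<le> 0" unfolding neg_le_0_iff_le by (intro add_nonneg_nonneg) simp_all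
      finally show False using odd by auto
    qed
    then have "r > 0" using pr by (simp add: zero_less_mult_iff)
    have "u^2 = a^4 + 22 * a^2 * b^2 + 125 * b^4"
      using X_def X ab pos \<open>r > 0\<close> r f2 by (simp add: power_mult_distrib)
    moreover have "e^2 = 4 * a^2 * b^2" using f f2 by (simp add: power_mult_distrib)
    moreover have "coprime a b" using \<open>coprime p r\<close> ab pos \<open>r > 0\<close> by simp
    ultimately show thesis using conclude by blast
  qed
  have "5^3 dvd p \<or> 5^3 dvd q"
    by (rule prime_elem_divprod_pow) (use copq prod in auto)
  then show thesis
  proof
    assume "5^3 dvd p"
    then show thesis using main[of q p] copq prod pq by (simp add: coprime_commute mult.commute)
  next
    assume "5^3 dvd q"
    then show thesis using main[of p q] copq prod pq by simp
  qed
qed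

text \<open>The lift through the dual isogeny. Here the equation says that \<open>4 * b^4\<close> is the difference of the
squares of \<open>w\<close> and \<open>a^2 + 11 * b^2\<close>. Half the sum and half the difference of \<open>\<bar>w\<bar>\<close> and
\<open>a^2 + 11 * b^2\<close> are therefore coprime factors of \<open>b^4\<close>, hence fourth powers, and their difference is
\<open>a^2 + 11 * b^2\<close>.\<close>

lemma isogenous_quartic_point_lifts:
  fixes a b w :: int
  assumes co: "coprime a b" and eq: "w^2 = a^4 + 22 * a^2 * b^2 + 125 * b^4"
  obtains c d where "coprime d c" "b^2 = c^2 * d^2" "a^2 = d^4 - 11 * d^2 * c^2 - c^4"
proof -
  define X where "X = a^2 + 11 * b^2"
  have sq: "\<bar>w\<bar>^2 = X^2 + 4 * b^4" unfolding X_def power2_abs eq by algebra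
  have "even (\<bar>w\<bar>^2 - X^2)" unfolding sq by simp
  then have "even (\<bar>w\<bar> - X)" by simp
  then obtain r where r: "\<bar>w\<bar> - X = 2 * r" by blast
  define s where "s = r + X"
  have rs: "X = s - r" "\<bar>w\<bar> = r + s" using r s_def by auto
  have prod: "r * s = b^4"
  proof -
    have "4 * (r * s) = \<bar>w\<bar>^2 - X^2" unfolding rs by algebra
    then show ?thesis using sq by simp
  qed
  have X0: "X \<ge> 0" by (simp add: X_def)
  have "X^2 \<le> \<bar>w\<bar>^2" unfolding sq by simp
  then have "X \<le> \<bar>w\<bar>" by (rule power2_le_imp_le) simp
  then have nonneg: "r \<ge> 0" "s \<ge> 0" using r s_def X0 by auto
  have cors: "coprime r s"
  proof (rule coprime_if_no_common_prime)
    fix l :: int assume l: "prime l" "l dvd r" "l dvd s"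
    have "l dvd b^4" using l prod by (metis dvd_mult2)
    then have lb: "l dvd b" using l prime_dvd_power by blast
    have "l dvd X" using l rs by (metis dvd_diff)
    moreover have "l dvd 11 * b^2" using lb by (simp add: power2_eq_square)
    ultimately have "l dvd a^2" unfolding X_def by (metis dvd_add_left_iff)
    then have "l dvd a" using l prime_dvd_power by blast
    then show False using lb co l by (meson coprime_common_divisor not_prime_unit)
  qed
  obtain c d where cd: "r = c^4" "s = d^4"
    using coprime_factors_of_power[OF cors prod] nonneg by (metis abs_of_nonneg)
  have "(b^2)^2 = ((c * d)^2)^2" using prod cd by (simp add: power_mult_distrib)
  then have b2: "b^2 = (c * d)^2" using power2_eq_iff_nonneg[of "b^2" "(c*d)^2"] by simp
  have "a^2 = d^4 - 11 * d^2 * c^2 - c^4"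
    using rs(1) cd b2 X_def by (simp add: power_mult_distrib mult.commute)
  moreover have "coprime d c" using cors cd by (simp add: coprime_commute)
  ultimately show thesis using that b2 by (simp add: power_mult_distrib)
qed

text \<open>Fermat's infinite descent. The two lifts compose to a division by 2 on the elliptic curve behind the
quartic and replace \<open>e\<close> by a proper divisor \<open>c\<close>, because \<open>e = 2 * a * d * c\<close> up to sign.\<close>

lemma quartic_trivial_points:
  fixes u e v :: int
  assumes "coprime u e" "v^2 = u^4 - 11 * u^2 * e^2 - e^4"
  shows "e = 0"
  using assms
proof (induction "nat \<bar>e\<bar>" arbitrary: u e v rule: less_induct)
  case less
  show ?case
  proof (rule ccontr)
    assume e0: "e \<noteq> 0"
    obtain a b where ab: "coprime a b" "e^2 = 4 * a^2 * b^2"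
      "u^2 = a^4 + 22 * a^2 * b^2 + 125 * b^4"
      using quartic_point_lifts[OF less.prems(1) e0 less.prems(2)] .
    obtain c d where cd: "coprime d c" "b^2 = c^2 * d^2" "a^2 = d^4 - 11 * d^2 * c^2 - c^4"
      using isogenous_quartic_point_lifts[OF ab(1,3)] .
    have e2: "e^2 = (2 * a * d * c)^2" using ab cd by (simp add: power_mult_distrib)
    then have "c \<noteq> 0" "a * d \<noteq> 0" using e0 by auto
    have "\<bar>e\<bar> = 2 * \<bar>a * d\<bar> * \<bar>c\<bar>" using e2 by (simp add: power2_eq_iff abs_mult) (auto simp: abs_mult)
    moreover have "\<bar>a * d\<bar> \<ge> 1" using \<open>a * d \<noteq> 0\<close> by linarith
    then have "2 * \<bar>a * d\<bar> * \<bar>c\<bar> \<ge> 2 * \<bar>c\<bar>" by (simp add: mult_right_mono)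
    ultimately have "nat \<bar>c\<bar> < nat \<bar>e\<bar>" using \<open>c \<noteq> 0\<close> by linarith
    then show False using less.hyps[OF _ cd(1,3)] \<open>c \<noteq> 0\<close> by simp
  qed
qed

text \<open>The equation defines an elliptic curve whose only rational points are the origin and the point at
infinity. Writing \<open>t = m / n\<close> in lowest terms, the pairwise coprime integers \<open>m\<close>, \<open>n\<close> and
\<open>m^2 - 11 * m * n - n^2\<close> have a square as product, so each is a square up to sign. Both
possible signs of \<open>m\<close> lead to the same quartic, because translation by \<open>(0, 0)\<close> sends \<open>t\<close> to
\<open>- 1 / t\<close>.\<close>

lemma square_discriminant_curve_points:
  fixes t y :: rat
  assumes eq: "y^2 = t * (t^2 - 11 * t - 1)"
  shows "t = 0"
proof (rule ccontr)
  assume t0: "t \<noteq> 0"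
  obtain m n where mn: "quotient_of t = (m, n)" by fastforce
  have t: "t = of_int m / of_int n" and n: "n > 0" and co: "coprime m n"
    using mn quotient_of_div quotient_of_denom_pos quotient_of_coprime by auto
  have m0: "m \<noteq> 0" using t t0 by auto
  define K where "K = m^2 - 11 * m * n - n^2"
  have "(y * of_int n^2)^2 = of_int (m * n * K)"
    using n unfolding power_mult_distrib eq t K_def by (simp add: field_simps power2_eq_square)
  then obtain z where z: "y * of_int n^2 = of_int z" using rat_square_eq_int by blast
  then have "of_int (m * n * K) = (of_int (z^2) :: rat)"
    using \<open>(y * of_int n^2)^2 = of_int (m * n * K)\<close> by simp
  then have mnK: "m * n * K = z^2" by (simp only: of_int_eq_iff)
  have coK: "coprime (m * n) K"
  proof (rule coprime_if_no_common_prime)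
    fix l :: int assume l: "prime l" "l dvd m * n" "l dvd K"
    have "l dvd m \<longleftrightarrow> l dvd n"
    proof -
      have "m^2 - n^2 = K + 11 * (m * n)" by (simp add: K_def)
      then have "l dvd m^2 - n^2" using l by (metis dvd_add dvd_mult)
      then have "l dvd m^2 \<longleftrightarrow> l dvd n^2" by (metis diff_add_cancel dvd_add_right_iff)
      then show ?thesis using l prime_dvd_power_iff by (metis pos2)
    qed
    then show False using co l by (metis coprime_common_divisor not_prime_unit prime_dvd_mult_iff)
  qed
  obtain x v where xv: "\<bar>m * n\<bar> = x^2" "\<bar>K\<bar> = v^2"
    using coprime_factors_of_power[OF coK mnK] .
  have "coprime \<bar>m\<bar> n" using co by simp
  moreover have "\<bar>m\<bar> * n = x^2" using xv n by (simp add: abs_mult)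
  ultimately obtain u e where ue: "\<bar>m\<bar> = u^2" "n = e^2"
    using coprime_factors_of_power[of "\<bar>m\<bar>" n x 2] n by (metis abs_abs abs_of_pos)
  have coue: "coprime u e" using \<open>coprime \<bar>m\<bar> n\<close> unfolding ue by simp
  have sgn: "m * K \<ge> 0" using mnK n
    by (metis zero_le_power2 mult.commute mult.left_commute zero_le_mult_iff not_less)
  show False
  proof (cases "m > 0")
    case True
    then have "K = v^2" "m = u^2" using sgn xv ue by (auto simp: zero_le_mult_iff)
    then have "v^2 = u^4 - 11 * u^2 * e^2 - e^4" using K_def ue by simp
    then show False using quartic_trivial_points coue n ue by fastforce
  next
    case False
    then have "m < 0" using m0 by simp
    then have "K = - (v^2)" "m = - (u^2)" using sgn xv ue by (auto simp: zero_le_mult_iff)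
    then have "v^2 = e^4 - 11 * e^2 * u^2 - u^4" using K_def ue by (simp add: algebra_simps)
    then show False using quartic_trivial_points[of e u v] coue ue m0 by (simp add: coprime_commute)
  qed
qed

section \<open>Points of order 5\<close>

text \<open>The given bijection transports addition of points to addition modulo 5, so the multiples of a
preimage \<open>P\<close> of 1 are known inside the subgroup without appeal to associativity of the
chord-tangent law. The bracketing \<open>(2 P + 2 P) + P\<close> is chosen because it involves only doublings
and one addition of opposite points.\<close>

lemma order_five_subgroup_point:
  assumes H: "subgroup H (torsion_group E)"
    and iso: "(torsion_group E)\<lparr>carrier := H\<rparr> \<cong> integer_mod_group 5"
  obtains P where "on_curve E P" "P \<noteq> Infinity"
    "add_point E P P \<noteq> Infinity"
    "add_point E (add_point E P P) (add_point E P P) \<noteq> Infinity"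
    "add_point E (add_point E (add_point E P P) (add_point E P P)) P = Infinity"
proof -
  have mult: "monoid.mult (torsion_group E) = add_point E"
    and one: "monoid.one (torsion_group E) = Infinity"
    by (simp_all add: torsion_group_def mordell_weil_def)
  obtain h where h: "h \<in> iso ((torsion_group E)\<lparr>carrier := H\<rparr>) (integer_mod_group 5)"
    using iso by (auto simp: is_iso_def)
  have add: "h (add_point E P Q) = (h P + h Q) mod 5" if "P \<in> H" "Q \<in> H" for P Q
    using h that by (auto simp: iso_def hom_def mult)
  have bij: "bij_betw h H {0..<5}"
    using h by (simp add: iso_def carrier_integer_mod_group)
  have closed: "add_point E P Q \<in> H" if "P \<in> H" "Q \<in> H" for P Q
    using subgroup.m_closed[OF H that] by (simp add: mult)
  have O: "Infinity \<in> H" using subgroup.one_closed[OF H] by (simp add: one)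
  have "h Infinity \<in> {0..<5}" using bij O by (auto simp: bij_betw_def)
  moreover have "h Infinity = (h Infinity + h Infinity) mod 5" using add[OF O O] by simp
  ultimately have hO: "h Infinity = 0" by auto presburger
  have "1 \<in> h ` H" using bij by (auto simp: bij_betw_def)
  then obtain P where P: "P \<in> H" "h P = 1" by force
  let ?Q = "add_point E P P"
  let ?R = "add_point E ?Q ?Q"
  have Q: "?Q \<in> H" "h ?Q = 2" using P closed add by auto
  have R: "?R \<in> H" "h ?R = 4" using Q closed add by auto
  have S: "add_point E ?R P \<in> H" "h (add_point E ?R P) = 0" using P R closed add by auto
  have inj: "inj_on h H" using bij by (simp add: bij_betw_def)
  have "add_point E ?R P = Infinity" using inj S O hO by (metis inj_onD)
  moreover have "on_curve E P" using subgroup.subset[OF H] P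
    by (auto simp: torsion_group_def mordell_weil_def)
  moreover have "P \<noteq> Infinity" "?Q \<noteq> Infinity" "?R \<noteq> Infinity"
    using P(2) Q(2) R(2) hO by auto
  ultimately show thesis using that by blast
qed

text \<open>With \<open>u = a3 / a2\<close>, the relation says that the curve is the rescaling by \<open>u\<close> of Tate's normal form
\<open>y^2 + (1 - t) * x * y - t * y = x^3 - t * x^2\<close>, the universal curve with a point of order 5 at the
origin, whose discriminant is \<open>t^5 * (t^2 - 11 * t - 1)\<close>.\<close>

lemma discriminant_tate_normal_form:
  fixes a1 a2 a3 :: rat
  assumes rel: "a3 * (a3 - a1 * a2) = - (a2^3)" and "a2 \<noteq> 0" "a3 \<noteq> 0"
  defines "t \<equiv> - (a2^3) / a3^2"
  shows "discriminant (Weierstrass a1 a2 a3 0 0) = ((a3 / a2)^6 * t^2)^2 * (t * (t^2 - 11 * t - 1))"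
proof -
  define u where "u = a3 / a2"
  have a2: "a2 = - t * u^2" and a3: "a3 = - t * u^3"
    using assms(2,3) by (simp_all add: u_def t_def power2_eq_square power3_eq_cube)
  have "a1 * (a2 * a3) = a3^2 + a2^3" using rel by algebra
  also have "\<dots> = ((1 - t) * u) * (a2 * a3)" unfolding a2 a3 by algebra
  finally have a1: "a1 = (1 - t) * u" using assms(2,3) by simp
  show ?thesis unfolding u_def[symmetric] unfolding a1 a2 a3 by (simp add: Let_def) algebra
qed

text \<open>The tangent slope \<open>l\<close> is described by a polynomial equation instead of a quotient, ready for
elimination.\<close>

lemma add_point_self_affine:
  fixes a1 a2 a3 a4 a6 x y :: rat
  defines "W \<equiv> Weierstrass a1 a2 a3 a4 a6"
  assumes "add_point W (Affine x y) (Affine x y) \<noteq> Infinity"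
  obtains l where "2 * y + a1 * x + a3 \<noteq> 0"
    "l * (2 * y + a1 * x + a3) = 3 * x^2 + 2 * a2 * x + a4 - a1 * y"
    "add_point W (Affine x y) (Affine x y) = Affine (l^2 + a1 * l - a2 - 2 * x)
      (- (l + a1) * (l^2 + a1 * l - a2 - 2 * x) - (y - l * x) - a3)"
proof -
  define l where "l = (3 * x^2 + 2 * a2 * x + a4 - a1 * y) / (2 * y + a1 * x + a3)"
  have ne: "y + y + a1 * x + a3 \<noteq> 0" using assms(2) by (auto simp: W_def)
  show thesis
  proof (rule that)
    show ne2: "2 * y + a1 * x + a3 \<noteq> 0" using ne by simp
    show "l * (2 * y + a1 * x + a3) = 3 * x^2 + 2 * a2 * x + a4 - a1 * y"
      using ne2 by (simp add: l_def)
    have "u - x - x = u - 2 * x" for u :: rat by simp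
    then show "add_point W (Affine x y) (Affine x y) = Affine (l^2 + a1 * l - a2 - 2 * x)
        (- (l + a1) * (l^2 + a1 * l - a2 - 2 * x) - (y - l * x) - a3)"
      using ne by (simp only: W_def add_point.simps Let_def l_def if_False simp_thms)
  qed
qed

text \<open>Move \<open>P\<close> to the origin and its tangent to the line \<open>y = 0\<close>; this kills the last two coefficients
and leaves \<open>c1\<close>, \<open>c2\<close>, \<open>c3\<close>. Since \<open>2 (2 P) = - P\<close>, the tangent at \<open>2 P\<close> passes through \<open>P\<close>.
This collinearity is a polynomial relation between the coefficients, and it is the one that
characterises Tate's normal form for order 5.\<close>

lemma discriminant_of_order_five:
  assumes P: "on_curve E P" "P \<noteq> Infinity"
    and Q: "add_point E P P \<noteq> Infinity"
    and R: "add_point E (add_point E P P) (add_point E P P) \<noteq> Infinity"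
    and S: "add_point E (add_point E (add_point E P P) (add_point E P P)) P = Infinity"
  obtains w t where "t \<noteq> 0" "w \<noteq> 0" "discriminant E = w^2 * (t * (t^2 - 11 * t - 1))"
proof -
  obtain a1 a2 a3 a4 a6 where E: "E = Weierstrass a1 a2 a3 a4 a6" by (cases E)
  obtain x y where Pxy: "P = Affine x y" using P(2) by (cases P) auto
  have curve: "y^2 + a1 * x * y + a3 * y = x^3 + a2 * x^2 + a4 * x + a6"
    using P(1) by (simp add: E Pxy)
  define c3 where "c3 = a3 + x * a1 + 2 * y"
  obtain l where "2 * y + a1 * x + a3 \<noteq> 0"
    and l: "l * (2 * y + a1 * x + a3) = 3 * x^2 + 2 * a2 * x + a4 - a1 * y"
    and PP: "add_point E P P = Affine (l^2 + a1 * l - a2 - 2 * x)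
      (- (l + a1) * (l^2 + a1 * l - a2 - 2 * x) - (y - l * x) - a3)"
    using add_point_self_affine[OF Q[unfolded E Pxy]] unfolding E Pxy .
  then have c3: "c3 \<noteq> 0" by (simp add: c3_def algebra_simps)
  define c1 where "c1 = a1 + 2 * l"
  define c2 where "c2 = a2 - l * a1 + 3 * x - l^2"
  have "change_of_variables 1 x l y E (Weierstrass c1 c2 c3 0 0)"
  proof -
    have "0 = a4 - l * a3 + 2 * x * a2 - (y + x * l) * a1 + 3 * x^2 - 2 * l * y"
      using l by algebra
    moreover have "0 = a6 + x * a4 + x^2 * a2 + x^3 - y * a3 - y^2 - x * y * a1"
      using curve by algebra
    ultimately show ?thesis unfolding E change_of_variables.simps
      by (simp add: c1_def c2_def c3_def)
  qed
  then have disc: "discriminant (Weierstrass c1 c2 c3 0 0) = discriminant E"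
    using discriminant_change_of_variables by fastforce
  define x2 where "x2 = x - c2"
  define y2 where "y2 = - (l + a1) * x2 - (y - l * x) - a3"
  have "l^2 + a1 * l - a2 - 2 * x = x2" by (simp add: x2_def c2_def)
  then have PP: "add_point E P P = Affine x2 y2" using PP by (simp add: y2_def)
  define d where "d = 2 * y2 + a1 * x2 + a3"
  obtain m where m: "m * d = 3 * x2^2 + 2 * a2 * x2 + a4 - a1 * y2"
    and QQ: "add_point E (Affine x2 y2) (Affine x2 y2) = Affine (m^2 + a1 * m - a2 - 2 * x2)
      (- (m + a1) * (m^2 + a1 * m - a2 - 2 * x2) - (y2 - m * x2) - a3)"
    using add_point_self_affine[OF R[unfolded PP, unfolded E]] unfolding E d_def .
  define x4 where "x4 = m^2 + a1 * m - a2 - 2 * x2"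
  define y4 where "y4 = - (m + a1) * x4 - (y2 - m * x2) - a3"
  have QQ: "add_point E (Affine x2 y2) (Affine x2 y2) = Affine x4 y4"
    using QQ by (simp only: x4_def y4_def)
  have "x4 = x" "y4 + y + a1 * x + a3 = 0"
    using S unfolding PP QQ unfolding E Pxy by (auto simp: Let_def split: if_splits)
  then have tangent: "m * (x2 - x) = y2 - y" by (simp add: y4_def algebra_simps)
  have y2: "y2 - y = (l + a1) * c2 - c3" unfolding y2_def x2_def c3_def by algebra
  have c2: "c2 \<noteq> 0" using tangent y2 c3 by (auto simp: x2_def)
  have rel: "c3 * (c3 - c1 * c2) = - (c2^3)"
  proof -
    \<comment> \<open>In the shifted coordinates, \<open>2 P\<close> is \<open>(- c2, c1 * c2 - c3)\<close> and the slope there is \<open>m - l\<close>.\<close>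
    have d': "d = c1 * c2 - c3" unfolding d_def y2_def x2_def c1_def c3_def by algebra
    have "3 * x2^2 + 2 * a2 * x2 + a4 - a1 * y2 = c2^2 + (l - c1) * d"
      unfolding d' unfolding y2_def x2_def c1_def using l by (simp add: c2_def c3_def) algebra
    then have "(m - l + c1) * d = c2^2" using m by (simp add: algebra_simps)
    moreover have "(m - l + c1) * c2 = c3"
      using tangent y2 unfolding x2_def c1_def by algebra
    ultimately show ?thesis unfolding d' by algebra
  qed
  show thesis
  proof (rule that)
    show "- (c2^3) / c3^2 \<noteq> 0" "(c3 / c2)^6 * (- (c2^3) / c3^2)^2 \<noteq> 0" using c2 c3 by auto
  qed (use discriminant_tate_normal_form[OF rel c2 c3] disc in simp)
qed

theorem proposition2:
  fixes E :: weierstrass and A B :: int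
  assumes elliptic: "elliptic_curve E"
    and C5: "\<exists>H. subgroup H (torsion_group E) \<and>
           (torsion_group E)\<lparr>carrier := H\<rparr> \<cong> integer_mod_group 5"
    and model: "short_model E A B"
  shows "\<not> (\<exists>q::rat. of_int (short_discriminant A B) = q^2)"
proof
  assume "\<exists>q::rat. of_int (short_discriminant A B) = q^2"
  then obtain q :: rat where q: "of_int (short_discriminant A B) = q^2" ..
  obtain z r s p where "change_of_variables z r s p E (short_weierstrass A B)"
    using model unfolding short_model_def by blast
  then have "discriminant E = z^12 * q^2"
    using discriminant_change_of_variables discriminant_short_weierstrass q by metis
  then have disc: "discriminant E = (z^6 * q)^2" by (simp add: power_mult_distrib)
  obtain w t where "t \<noteq> 0" "w \<noteq> 0"
    and wt: "discriminant E = w^2 * (t * (t^2 - 11 * t - 1))"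
    using C5 order_five_subgroup_point discriminant_of_order_five by metis
  have "(z^6 * q / w)^2 = t * (t^2 - 11 * t - 1)"
    using disc wt \<open>w \<noteq> 0\<close> by (simp add: power_divide divide_eq_eq mult.commute)
  then show False using square_discriminant_curve_points \<open>t \<noteq> 0\<close> by blast
qed

end
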